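(* Let $\phi_{\mathrm{SD}}$ be the score-driven updating rule $\phi_{\mathrm{SD}}(y,\vartheta_{t|t-1})=\vartheta_{t|t-1}+\mathcal{A}_{t-1}\,s(y,\vartheta_{t|t-1})$ with a (symmetric) positive definite $k\times k$ matrix $\mathcal{A}_{t-1}$ known given $\mathcal{F}_{t-1}$, and let $\mathcal{P}$ be a class of true densities. Assume: (1) $\Theta\subseteq\mathbb{R}^k$ is open and convex, $\vartheta_{t|t-1}\in\Theta$ and $\vartheta_{t|t}(Y_t)=\phi_{\mathrm{SD}}(Y_t,\vartheta_{t|t-1})\in\Theta$ (almost surely); (2) $\log f(x|\vartheta)$ is twice continuously differentiable in $\vartheta$ for all $\vartheta\in\Theta$ and $x\in\mathcal{Y}$; (3) $\mathbb{E}_{p_t}[s(X_t,\vartheta_{t|t-1})]$ and $\mathbb{E}_{p_t}[\|\Delta\phi_{\mathrm{SD}}(Y_t,\vartheta_{t|t-1})\|^2]$ are finite for all $\vartheta_{t|t-1}\in\Theta$ and $p_t\in\mathcal{P}$; (4) there is a constant $0<c<\infty$ such that $\sup_{\vartheta\in\Theta}\|\mathbb{E}_{p_t}[H(X_t,\vartheta)]\|\le c$ for all $p_t\in\mathcal{P}$. For a given $\vartheta_{t|t-1}\in\Theta$, let $p_t\in\mathcal{P}$ be such that $\mu_{p_t}:=\mathbb{E}_{p_t}[s(Y_t,\vartheta_{t|t-1})]\neq0$, with elements $\mu_1,\dots,\mu_k$, and let $\Sigma_{p_t}:=\mathbb{E}_{p_t}[s(Y_t,\vartheta_{t|t-1})s(Y_t,\vartheta_{t|t-1})^\top]-\mu_{p_t}\mu_{p_t}^\top$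 be finite with diagonal elements $\sigma_1^2,\dots,\sigma_k^2$. Then $\Delta^{\mathsf{EKL}}(\phi_{\mathrm{SD}}|\vartheta_{t|t-1},p_t)<0$ holds in each of the following cases: (A) $\mathcal{A}_{t-1}=\alpha_{t-1}I_k$ is positive definite and $$\alpha_{t-1}<\frac{2}{c}\,\frac{\|\mu_{p_t}\|^2}{\|\mu_{p_t}\|^2+\operatorname{tr}(\Sigma_{p_t})};$$ (B) $\mathcal{A}_{t-1}=\operatorname{diag}(\alpha_{1,t-1},\dots,\alpha_{k,t-1})$ is diagonal and positive definite, the elements $\mu_1,\dots,\mu_k$ are all non-zero, and $$\alpha_{i,t-1}\le\frac{2}{c}\,\frac{\mu_i^2}{\mu_i^2+\sigma_i^2},\qquad i=1,\dots,k,$$ with strict inequality for at least one $i\in\{1,\dots,k\}$; (C) $\mathcal{A}_{t-1}$ is a general positive definite matrix and $$\frac{\lambda_{\max}(\mathcal{A}_{t-1})^2}{\lambda_{\min}(\mathcal{A}_{t-1})}<\frac{2}{c}\,\frac{\|\mu_{p_t}\|^2}{\|\mu_{p_t}\|^2+\operatorname{tr}(\Sigma_{p_t})}.$$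
   Context: Setting. Let $\mathcal{Y}\subseteq\mathbb{R}^l$ be the outcome space and fix a time $t$. Conditionally on the information set $\mathcal{F}_{t-1}$ at time $t-1$, the observation $Y_t$ has true density $p_t$ on $\mathcal{Y}$, belonging to a class $\mathcal{P}$ of absolutely continuous distributions (identified with their densities). Quantities known given $\mathcal{F}_{t-1}$, such as the predicted parameter $\vartheta_{t|t-1}\in\Theta$ and $\mathcal{A}_{t-1}$, are treated as fixed. $\mathbb{E}_{p_t}$ denotes expectation under $p_t$, and $X_t$ denotes an independent copy of $Y_t$. The postulated (possibly misspecified) model is a family of densities $f(\cdot|\vartheta)$, $\vartheta\in\Theta\subseteq\mathbb{R}^k$; the support of $p_t$ is assumed to be contained in the support of $f(\cdot|\vartheta)$ for all $\vartheta\in\Theta$. The score is $s(y,\vartheta)=\frac{\partial}{\partial\vartheta}\log f(y|\vartheta)$ and the Hessian is $H(x,\vartheta)=\frac{\partial^2}{\partial\vartheta\,\partial\vartheta^\top}\log f(x|\vartheta)$. $\|\cdot\|$ is the Euclidean norm for vectors and the spectral norm for matrices; $I_k$ is the identity matrix; $\lambda_{\min},\lambda_{\max}$ are extremal eigenvalues. Updating rules. For an updating rule $\phi:\mathcal{Y}\times\Theta\to\Theta$, the updated parameter is $\vartheta_{t|t}(y)=\phi(y,\vartheta_{t|t-1})$ and $\Delta\phi(y,\vartheta_{t|t-1}):=\vartheta_{t|t}(y)-\vartheta_{t|t-1}$. EKL. For an updating rule $\phi$ with $\vartheta_{t|t}(y)=\phi(y,\vartheta_{t|t-1})$, $$\mathsf{EKL}(p_t\Vert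 f_{t|t}):=\int_{\mathcal{Y}}\int_{\mathcal{Y}}\log\Big(\frac{p_t(x)}{f(x|\vartheta_{t|t}(y))}\Big)p_t(x)\,p_t(y)\,dx\,dy,$$ $$\mathsf{EKL}(p_t\Vert f_{t|t-1})=\int_{\mathcal{Y}}\log\Big(\frac{p_t(x)}{f(x|\vartheta_{t|t-1})}\Big)p_t(x)\,dx,$$ assumed finite throughout, and $\Delta^{\mathsf{EKL}}(\phi|\vartheta_{t|t-1},p_t):=\mathsf{EKL}(p_t\Vert f_{t|t})-\mathsf{EKL}(p_t\Vert f_{t|t-1})$.
   Formalization: Added: for each η in Θ, with d=η−ϑ_{t|t-1}, dᵀH(x,ϑ_{t|t-1}+ud)d is absolutely integrable over x~p_t and u in [0,1] (so expectation and Taylor remainder integral can be exchanged); without it the claim is false, since (4) bounds only the norm of E[H]. *)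

theory Defs
  imports "HOL-Analysis.Analysis"
begin

section \<open>Densities on the outcome space\<close>

definition is_density_on :: "'a::euclidean_space set \<Rightarrow> ('a \<Rightarrow> real) \<Rightarrow> bool" where
  "is_density_on Y p \<longleftrightarrow>
     p \<in> borel_measurable (restrict_space lborel Y) \<and>
     (\<forall>x\<in>Y. 0 \<le> p x) \<and>
     (\<integral>\<^sup>+ x. ennreal (p x) \<partial>restrict_space lborel Y) = 1"

text \<open>Expectations under \<open>p\<close> are Bochner integrals with respect to \<open>law Y p\<close>; existence of such
  an expectation has to be required separately, because the integral of a non-integrable function
  is 0.\<close>

definition law :: "'a::euclidean_space set \<Rightarrow> ('a \<Rightarrow> real) \<Rightarrow> 'a measure" where
  "law Y p = density (restrict_space lborel Y) (\<lambda>x. ennreal (p x))"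

section \<open>Score and Hessian of a parametric family\<close>

definition score :: "('a \<Rightarrow> real^'k \<Rightarrow> real) \<Rightarrow> 'a \<Rightarrow> real^'k \<Rightarrow> real^'k" where
  "score f y \<theta> = (\<chi> i. frechet_derivative (\<lambda>\<eta>. ln (f y \<eta>)) (at \<theta>) (axis i 1))"

definition hessian :: "('a \<Rightarrow> real^'k \<Rightarrow> real) \<Rightarrow> 'a \<Rightarrow> real^'k \<Rightarrow> real^'k^'k" where
  "hessian f x \<theta> = jacobian (score f x) (at \<theta>)"

text \<open>Since \<open>ln 0 = 0\<close>, this alone does not say that the family is positive; that is the
  role of \<open>support_contained\<close> below.\<close>

definition loglik_C2_on :: "('a \<Rightarrow> real^'k \<Rightarrow> real) \<Rightarrow> 'a \<Rightarrow> (real^'k) set \<Rightarrow> bool" where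
  "loglik_C2_on f x \<Theta> \<longleftrightarrow>
     (\<lambda>\<theta>. ln (f x \<theta>)) differentiable_on \<Theta> \<and>
     score f x differentiable_on \<Theta> \<and>
     continuous_on \<Theta> (hessian f x)"

definition support_contained ::
  "'a set \<Rightarrow> ('a \<Rightarrow> real) \<Rightarrow> ('a \<Rightarrow> real^'k \<Rightarrow> real) \<Rightarrow> (real^'k) set \<Rightarrow> bool" where
  "support_contained Y p f \<Theta> \<longleftrightarrow> (\<forall>\<theta>\<in>\<Theta>. {x\<in>Y. 0 < p x} \<subseteq> {x\<in>Y. 0 < f x \<theta>})"

section \<open>Matrices\<close>

definition pos_def :: "real^'n^'n \<Rightarrow> bool" where
  "pos_def A \<longleftrightarrow> transpose A = A \<and> (\<forall>v. v \<noteq> 0 \<longrightarrow> 0 < v \<bullet> (A *v v))"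

definition eigenvalues :: "real^'n^'n \<Rightarrow> real set" where
  "eigenvalues A = {l. \<exists>v. v \<noteq> 0 \<and> A *v v = l *\<^sub>R v}"

definition lambda_max :: "real^'n^'n \<Rightarrow> real" where
  "lambda_max A = Max (eigenvalues A)"

definition lambda_min :: "real^'n^'n \<Rightarrow> real" where
  "lambda_min A = Min (eigenvalues A)"

definition spectral_norm :: "real^'n^'m \<Rightarrow> real" where
  "spectral_norm A = onorm ((*v) A)"

definition diag_mat :: "real^'n \<Rightarrow> real^'n^'n" where
  "diag_mat a = (\<chi> i j. if i = j then a $ i else 0)"

definition outer_prod :: "real^'n \<Rightarrow> real^'n \<Rightarrow> real^'n^'n" where
  "outer_prod v w = (\<chi> i j. v $ i * w $ j)"

section \<open>Mean and covariance of the score\<close>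

definition score_mean ::
  "(real^'l) set \<Rightarrow> (real^'l \<Rightarrow> real) \<Rightarrow> (real^'l \<Rightarrow> real^'k \<Rightarrow> real) \<Rightarrow> real^'k \<Rightarrow> real^'k" where
  "score_mean Y p f \<theta> = (\<integral>y. score f y \<theta> \<partial>law Y p)"

definition score_cov ::
  "(real^'l) set \<Rightarrow> (real^'l \<Rightarrow> real) \<Rightarrow> (real^'l \<Rightarrow> real^'k \<Rightarrow> real) \<Rightarrow> real^'k \<Rightarrow> real^'k^'k" where
  "score_cov Y p f \<theta> =
     (\<integral>y. outer_prod (score f y \<theta>) (score f y \<theta>) \<partial>law Y p)
     - outer_prod (score_mean Y p f \<theta>) (score_mean Y p f \<theta>)"

section \<open>Updating rules and expected Kullback-Leibler divergence\<close>

definition sd_update ::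
  "('a \<Rightarrow> real^'k \<Rightarrow> real) \<Rightarrow> real^'k^'k \<Rightarrow> 'a \<Rightarrow> real^'k \<Rightarrow> real^'k" where
  "sd_update f A y \<theta> = \<theta> + A *v score f y \<theta>"

definition update_step :: "('a \<Rightarrow> real^'k \<Rightarrow> real^'k) \<Rightarrow> 'a \<Rightarrow> real^'k \<Rightarrow> real^'k" where
  "update_step \<phi> y \<theta> = \<phi> y \<theta> - \<theta>"

definition EKL_updated ::
  "(real^'l) set \<Rightarrow> (real^'l \<Rightarrow> real) \<Rightarrow> (real^'l \<Rightarrow> real^'k \<Rightarrow> real) \<Rightarrow>
   (real^'l \<Rightarrow> real^'k \<Rightarrow> real^'k) \<Rightarrow> real^'k \<Rightarrow> real" where
  "EKL_updated Y p f \<phi> \<theta> =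
     (LINT y:Y|lborel. LINT x:Y|lborel. ln (p x / f x (\<phi> y \<theta>)) * p x * p y)"

definition EKL_predicted ::
  "(real^'l) set \<Rightarrow> (real^'l \<Rightarrow> real) \<Rightarrow> (real^'l \<Rightarrow> real^'k \<Rightarrow> real) \<Rightarrow> real^'k \<Rightarrow> real" where
  "EKL_predicted Y p f \<theta> = (LINT x:Y|lborel. ln (p x / f x \<theta>) * p x)"

text \<open>Finiteness of the double integral is absolute integrability on \<open>Y \<times> Y\<close>. The negative part
  of the integrand always has integral at most 1, by \<open>ln u \<le> u - 1\<close>, so this is the same as
  finiteness of the iterated extended-real integral.\<close>

definition EKL_finite ::
  "(real^'l) set \<Rightarrow> (real^'l \<Rightarrow> real) \<Rightarrow> (real^'l \<Rightarrow> real^'k \<Rightarrow> real) \<Rightarrow>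
   (real^'l \<Rightarrow> real^'k \<Rightarrow> real^'k) \<Rightarrow> real^'k \<Rightarrow> bool" where
  "EKL_finite Y p f \<phi> \<theta> \<longleftrightarrow>
     set_integrable (lborel \<Otimes>\<^sub>M lborel) (Y \<times> Y)
       (\<lambda>(y, x). ln (p x / f x (\<phi> y \<theta>)) * p x * p y) \<and>
     set_integrable lborel Y (\<lambda>x. ln (p x / f x \<theta>) * p x)"

definition Delta_EKL ::
  "(real^'l) set \<Rightarrow> (real^'l \<Rightarrow> real^'k \<Rightarrow> real) \<Rightarrow>
   (real^'l \<Rightarrow> real^'k \<Rightarrow> real^'k) \<Rightarrow> real^'k \<Rightarrow> (real^'l \<Rightarrow> real) \<Rightarrow> real" where
  "Delta_EKL Y f \<phi> \<theta> p = EKL_updated Y p f \<phi> \<theta> - EKL_predicted Y p f \<theta>"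

text \<open>The second-order Taylor remainder of \<open>ln f(x|\<cdot>)\<close> between \<open>\<theta>\<close> and \<open>\<eta>\<close> is the integral over
  \<open>u \<in> [0,1]\<close> of \<open>(1 - u) (\<eta> - \<theta>)\<^sup>T H(x, \<theta> + u (\<eta> - \<theta>)) (\<eta> - \<theta>)\<close>. The following is the Fubini
  condition that allows its expectation over \<open>x\<close> to be taken inside the integral over \<open>u\<close>, where
  a bound on the expected Hessian applies. Pointwise existence and boundedness of the expected
  Hessian do not imply it; it holds whenever the norm of the Hessian is dominated by an integrable
  function of \<open>x\<close> locally uniformly in the parameter.\<close>

definition taylor_interchange ::
  "(real^'l) set \<Rightarrow> (real^'l \<Rightarrow> real) \<Rightarrow> (real^'l \<Rightarrow> real^'k \<Rightarrow> real) \<Rightarrow>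
   (real^'k) set \<Rightarrow> real^'k \<Rightarrow> bool" where
  "taylor_interchange Y p f \<Theta> \<theta> \<longleftrightarrow>
     (\<forall>\<eta>\<in>\<Theta>. integrable (law Y p \<Otimes>\<^sub>M restrict_space lborel {0..1})
        (\<lambda>(x, u). (\<eta> - \<theta>) \<bullet> (hessian f x (\<theta> + u *\<^sub>R (\<eta> - \<theta>)) *v (\<eta> - \<theta>))))"

end

theory Submission
  imports Defs "HOL-Probability.Probability_Measure"
begin

text \<open>
  The expected log-likelihood \<open>\<eta> \<mapsto> E[ln f(X|\<eta>)]\<close> has gradient \<open>\<mu>\<close> at \<open>\<theta>\<close>, and its curvature is
  bounded by \<open>c\<close>. As in the descent lemma of smooth optimisation, an integrated Taylor expansion
  gives, for every fixed \<open>\<eta> \<in> \<Theta>\<close>,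
  \<open>KL(p, f(\<cdot>|\<eta>)) \<le> KL(p, f(\<cdot>|\<theta>)) - \<mu> \<bullet> (\<eta> - \<theta>) + c/2 |\<eta> - \<theta>|\<^sup>2\<close>.
  Only the expected Hessian is bounded, so the expectation over \<open>X\<close> has to be moved inside the
  remainder integral before the bound applies (\<open>expected_loglik_gain\<close>).

  The score-driven update evaluates this at the random point \<open>\<eta> = \<theta> + A s(Y)\<close>, with \<open>Y\<close> independent
  of \<open>X\<close>. Averaging over \<open>Y\<close> (\<open>EKL_updated_le\<close>) turns the linear term into \<open>\<mu> \<bullet> A \<mu>\<close>, so that
  \<open>Delta_EKL \<le> c/2 E|A s(Y)|\<^sup>2 - \<mu> \<bullet> A \<mu>\<close> (\<open>Delta_EKL_score_driven_le\<close>): a first-order gain against a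
  second-order cost that scales with the square of the learning rate.

  The denominators in the three step-size conditions are second moments of the score, since
  \<open>|\<mu>|\<^sup>2 + tr \<Sigma> = E|s|\<^sup>2\<close> and \<open>\<mu>\<^sub>i\<^sup>2 + \<sigma>\<^sub>i\<^sup>2 = E s\<^sub>i\<^sup>2\<close>. For \<open>A = \<alpha> I\<close> and for diagonal \<open>A\<close>, the cost and the
  gain are explicit, in the diagonal case coordinate by coordinate, and the conditions say exactly
  that the gain wins. For general \<open>A\<close> the gain is at least \<open>lambda_min A |\<mu>|\<^sup>2\<close> and the cost at most
  \<open>c/2 (lambda_max A)\<^sup>2 E|s|\<^sup>2\<close>; this needs the extremal eigenvalues to control the quadratic form and the
  norm, which is derived from the variational characterisation of the smallest eigenvalue.
\<close>

section \<open>Quadratic forms of symmetric matrices\<close>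

lemma symmetric_inner:
  fixes A :: "real^'n^'n"
  assumes "transpose A = A"
  shows "u \<bullet> (A *v v) = (A *v u) \<bullet> v"
  by (metis assms dot_lmul_matrix transpose_matrix_vector)

text \<open>
  The form \<open>\<langle>u, v\<rangle> = u \<bullet> B v\<close> need not be definite, so the usual discriminant argument has the
  extra case \<open>u \<bullet> B u = 0\<close>, where an affine function of \<open>t\<close> is bounded below and hence constant.
\<close>

lemma semidefinite_Cauchy_Schwarz:
  fixes B :: "real^'n^'n"
  assumes sym: "transpose B = B" and psd: "\<And>v. 0 \<le> v \<bullet> (B *v v)"
  shows "(u \<bullet> (B *v v))\<^sup>2 \<le> (u \<bullet> (B *v u)) * (v \<bullet> (B *v v))"
proof -
  define a b d where "a = u \<bullet> (B *v u)" and "b = u \<bullet> (B *v v)" and "d = v \<bullet> (B *v v)"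
  have quad: "0 \<le> a * t\<^sup>2 + 2 * b * t + d" for t
  proof -
    have "v \<bullet> (B *v u) = b"
      using symmetric_inner[OF sym, of v u] by (simp add: b_def inner_commute)
    then have "(t *\<^sub>R u + v) \<bullet> (B *v (t *\<^sub>R u + v)) = a * t\<^sup>2 + 2 * b * t + d"
      by (simp add: a_def b_def d_def matrix_vector_mult_scaleR
          inner_simps algebra_simps power2_eq_square)
    then show ?thesis using psd by metis
  qed
  have "b\<^sup>2 \<le> a * d"
  proof (cases "a = 0")
    case True
    have "b = 0"
    proof (rule ccontr)
      assume "b \<noteq> 0"
      \<comment> \<open>at this \<open>t\<close> the affine function takes the value \<open>- 1\<close>\<close>
      then show False using quad[of "- (d + 1) / (2 * b)"] True by simp
    qed
    then show ?thesis using True by simp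
  next
    case False
    then have a: "0 < a" using psd[of u] by (simp add: a_def)
    \<comment> \<open>the vertex of the parabola\<close>
    have "0 \<le> a * (- b / a)\<^sup>2 + 2 * b * (- b / a) + d" by (rule quad)
    also have "\<dots> = d - b\<^sup>2 / a" using a by (simp add: field_simps power2_eq_square)
    finally show ?thesis using a by (simp add: field_simps)
  qed
  then show ?thesis by (simp add: a_def b_def d_def)
qed

text \<open>
  Eigenvectors for distinct eigenvalues are orthogonal, so choosing one for each eigenvalue gives
  an independent set. Finiteness is what makes the \<open>Max\<close> and \<open>Min\<close> in \<open>lambda_max\<close> and \<open>lambda_min\<close>
  meaningful.
\<close>

lemma finite_eigenvalues_symmetric:
  fixes A :: "real^'n^'n"
  assumes sym: "transpose A = A"
  shows "finite (eigenvalues A)"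
proof -
  have "\<forall>l\<in>eigenvalues A. \<exists>v. v \<noteq> 0 \<and> A *v v = l *\<^sub>R v" by (simp add: eigenvalues_def)
  then obtain e where e: "\<And>l. l \<in> eigenvalues A \<Longrightarrow> e l \<noteq> 0 \<and> A *v e l = l *\<^sub>R e l"
    by metis
  have orth: "e l \<bullet> e m = 0" if "l \<in> eigenvalues A" "m \<in> eigenvalues A" "l \<noteq> m" for l m
  proof -
    have "m * (e l \<bullet> e m) = l * (e l \<bullet> e m)"
      using symmetric_inner[OF sym, of "e l" "e m"] e that by simp
    then show ?thesis using that by simp
  qed
  have inj: "inj_on e (eigenvalues A)"
    by (rule inj_onI) (metis e orth inner_eq_zero_iff)
  have "pairwise orthogonal (e ` eigenvalues A)"
    unfolding pairwise_def orthogonal_def using orth by auto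
  then have "independent (e ` eigenvalues A)"
    using e by (intro pairwise_orthogonal_independent) auto
  then have "finite (e ` eigenvalues A)" by (rule independent_imp_finite)
  then show ?thesis using inj by (simp add: finite_image_iff)
qed

text \<open>
  The quadratic form attains its minimum \<open>m\<close> over the unit sphere at some \<open>w\<close>. Then \<open>B = A - m I\<close> is
  positive semidefinite with \<open>w \<bullet> B w = 0\<close>, and the Cauchy-Schwarz inequality for \<open>B\<close>, applied to
  \<open>B w\<close> and \<open>w\<close>, forces \<open>B w = 0\<close>: the minimum is an eigenvalue.
\<close>

lemma ex_eigenvalue_le_quadratic_form:
  fixes A :: "real^'n^'n"
  assumes sym: "transpose A = A"
  shows "\<exists>m\<in>eigenvalues A. \<forall>v. m * (norm v)\<^sup>2 \<le> v \<bullet> (A *v v)"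
proof -
  have "\<exists>w\<in>sphere 0 1. \<forall>v\<in>sphere 0 1. w \<bullet> (A *v w) \<le> v \<bullet> (A *v v)"
    by (rule continuous_attains_inf) (auto intro!: continuous_intros)
  then obtain w where w: "norm w = 1"
    and min: "\<And>v. norm v = 1 \<Longrightarrow> w \<bullet> (A *v w) \<le> v \<bullet> (A *v v)"
    by auto
  define m where "m = w \<bullet> (A *v w)"
  define B where "B = A - m *\<^sub>R mat 1"
  have B: "B *v v = A *v v - m *\<^sub>R v" for v
    by (simp add: B_def matrix_vector_mult_diff_rdistrib flip: scaleR_matrix_vector_assoc)
  have bound: "m * (norm v)\<^sup>2 \<le> v \<bullet> (A *v v)" for v
  proof (cases "v = 0")
    case False
    define e where "e = v /\<^sub>R norm v"
    have v: "v = norm v *\<^sub>R e" and "norm e = 1" using False by (simp_all add: e_def)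
    have "v \<bullet> (A *v v) = (norm v)\<^sup>2 * (e \<bullet> (A *v e))"
      by (subst (1 2) v) (simp add: matrix_vector_mult_scaleR power2_eq_square)
    then show ?thesis
      using mult_left_mono[OF min[OF \<open>norm e = 1\<close>], of "(norm v)\<^sup>2"]
      by (simp add: m_def mult.commute)
  qed simp
  have symB: "transpose B = B"
    using sym by (simp add: B_def transpose_def vec_eq_iff mat_def)
  have "0 \<le> v \<bullet> (B *v v)" for v
    using bound[of v] by (simp add: B inner_diff_right power2_norm_eq_inner)
  from semidefinite_Cauchy_Schwarz[OF symB this, of "B *v w" w]
  have "((B *v w) \<bullet> (B *v w))\<^sup>2 \<le> 0"
    using w by (simp add: B inner_diff_right m_def dot_square_norm)
  then have "A *v w = m *\<^sub>R w" by (simp add: B)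
  moreover have "w \<noteq> 0" using w by auto
  ultimately have "m \<in> eigenvalues A" by (auto simp: eigenvalues_def)
  then show ?thesis using bound by blast
qed

lemma lambda_min_quadratic_form_le:
  assumes "transpose A = A"
  shows "lambda_min A * (norm v)\<^sup>2 \<le> v \<bullet> (A *v v)"
proof -
  obtain m where m: "m \<in> eigenvalues A" "m * (norm v)\<^sup>2 \<le> v \<bullet> (A *v v)"
    using ex_eigenvalue_le_quadratic_form[OF assms] by blast
  have "lambda_min A \<le> m"
    unfolding lambda_min_def using finite_eigenvalues_symmetric[OF assms] m(1) by simp
  then have "lambda_min A * (norm v)\<^sup>2 \<le> m * (norm v)\<^sup>2" by (simp add: mult_right_mono)
  then show ?thesis using m(2) by simp
qed

text \<open>
  The lower bound, applied to \<open>- A\<close>.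
\<close>

lemma quadratic_form_le_lambda_max:
  assumes "transpose A = A"
  shows "v \<bullet> (A *v v) \<le> lambda_max A * (norm v)\<^sup>2"
proof -
  have neg: "(- A) *v u = - (A *v u)" for u
    by (simp add: matrix_vector_mult_def vec_eq_iff sum_negf)
  have "transpose (- A) = - A"
    using assms by (simp add: transpose_def vec_eq_iff)
  from ex_eigenvalue_le_quadratic_form[OF this]
  obtain m where m: "m \<in> eigenvalues (- A)" "m * (norm v)\<^sup>2 \<le> - (v \<bullet> (A *v v))"
    by (auto simp: neg)
  have "- m \<in> eigenvalues A"
    using m(1) by (auto simp: eigenvalues_def neg) (metis minus_equation_iff)
  then have "- m \<le> lambda_max A"
    unfolding lambda_max_def using finite_eigenvalues_symmetric[OF assms] by simp
  then have "- m * (norm v)\<^sup>2 \<le> lambda_max A * (norm v)\<^sup>2" by (intro mult_right_mono) simp_all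
  then show ?thesis using m(2) by simp
qed

lemma pos_def_lambda_min_pos:
  assumes "pos_def A"
  shows "0 < lambda_min A"
proof -
  have sym: "transpose A = A" using assms by (simp add: pos_def_def)
  have "eigenvalues A \<noteq> {}" using ex_eigenvalue_le_quadratic_form[OF sym] by blast
  then have "lambda_min A \<in> eigenvalues A"
    unfolding lambda_min_def by (intro Min_in finite_eigenvalues_symmetric sym)
  then obtain v where v: "v \<noteq> 0" "A *v v = lambda_min A *\<^sub>R v"
    by (auto simp: eigenvalues_def)
  have "0 < v \<bullet> (A *v v)" using assms v(1) by (simp add: pos_def_def)
  also have "v \<bullet> (A *v v) = lambda_min A * (norm v)\<^sup>2"
    by (simp add: v(2) power2_norm_eq_inner)
  finally show ?thesis by (simp add: zero_less_mult_iff)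
qed

text \<open>
  With \<open>w = A v\<close>, the Cauchy-Schwarz inequality for \<open>A\<close> gives
  \<open>|w|\<^sup>4 = (w \<bullet> A v)\<^sup>2 \<le> (w \<bullet> A w) (v \<bullet> A v)\<close>, and both factors are bounded by \<open>lambda_max A\<close>.
\<close>

lemma pos_def_norm_le_lambda_max:
  assumes pd: "pos_def A"
  shows "(norm (A *v v))\<^sup>2 \<le> (lambda_max A)\<^sup>2 * (norm v)\<^sup>2"
proof (cases "A *v v = 0")
  case False
  have sym: "transpose A = A" using pd by (simp add: pos_def_def)
  have psd: "0 \<le> u \<bullet> (A *v u)" for u
    using pd by (cases "u = 0") (auto simp: pos_def_def less_imp_le)
  define w where "w = A *v v"
  define L where "L = lambda_max A"
  have w: "0 < (norm w)\<^sup>2" using False by (simp add: w_def)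
  have L: "u \<bullet> (A *v u) \<le> L * (norm u)\<^sup>2" for u
    unfolding L_def by (rule quadratic_form_le_lambda_max[OF sym])
  have "0 \<le> L" using L[of w] psd[of w] w by (smt (verit) mult_neg_pos)
  have "((norm w)\<^sup>2)\<^sup>2 = (w \<bullet> (A *v v))\<^sup>2" by (simp add: w_def power2_norm_eq_inner)
  also have "\<dots> \<le> (w \<bullet> (A *v w)) * (v \<bullet> (A *v v))"
    by (rule semidefinite_Cauchy_Schwarz[OF sym psd])
  also have "\<dots> \<le> (L * (norm w)\<^sup>2) * (L * (norm v)\<^sup>2)"
    using \<open>0 \<le> L\<close> by (intro mult_mono L psd) simp_all
  finally have "(norm w)\<^sup>2 * (norm w)\<^sup>2 \<le> (norm w)\<^sup>2 * (L\<^sup>2 * (norm v)\<^sup>2)"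
    by (simp add: power2_eq_square algebra_simps)
  then have "(norm w)\<^sup>2 \<le> L\<^sup>2 * (norm v)\<^sup>2"
    using w by (rule mult_left_le_imp_le)
  then show ?thesis by (simp add: w_def L_def)
qed simp

section \<open>Second-order expansion of the log-likelihood\<close>

text \<open>
  The score collects partial derivatives and the Hessian is a Jacobian matrix; differentiability
  makes both represent the total derivative.
\<close>

lemma loglik_C2_has_derivative:
  assumes "open \<Theta>" "loglik_C2_on f x \<Theta>" "\<theta> \<in> \<Theta>"
  shows "((\<lambda>\<eta>. ln (f x \<eta>)) has_derivative (\<lambda>v. score f x \<theta> \<bullet> v)) (at \<theta>)"
    and "(score f x has_derivative (\<lambda>v. hessian f x \<theta> *v v)) (at \<theta>)"
proof -
  let ?g = "\<lambda>\<eta>. ln (f x \<eta>)" and ?D = "frechet_derivative (\<lambda>\<eta>. ln (f x \<eta>)) (at \<theta>)"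
  have "?g differentiable at \<theta>" and s: "score f x differentiable at \<theta>"
    using assms by (auto simp: loglik_C2_on_def differentiable_on_def at_within_open[of \<theta> \<Theta>])
  then have D: "(?g has_derivative ?D) (at \<theta>)" by (simp add: frechet_derivative_works)
  then interpret D: linear ?D by (rule has_derivative_linear)
  have "?D v = score f x \<theta> \<bullet> v" for v
  proof -
    have "?D v = ?D (\<Sum>i\<in>UNIV. v $ i *\<^sub>R axis i 1)"
      using basis_expansion[of v] by (simp add: scalar_mult_eq_scaleR)
    also have "\<dots> = (\<Sum>i\<in>UNIV. v $ i * ?D (axis i 1))"
      by (simp add: D.sum D.scaleR)
    finally show ?thesis by (simp add: score_def inner_vec_def mult.commute)
  qed
  then have "?D = (\<lambda>v. score f x \<theta> \<bullet> v)" by (rule ext)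
  then show "(?g has_derivative (\<lambda>v. score f x \<theta> \<bullet> v)) (at \<theta>)" using D by simp
  show "(score f x has_derivative (\<lambda>v. hessian f x \<theta> *v v)) (at \<theta>)"
    using s unfolding hessian_def by (simp add: jacobian_works)
qed

text \<open>
  Along the segment, \<open>(1 - u) h''(u)\<close> is the derivative of \<open>h(u) + (1 - u) h'(u)\<close>, where
  \<open>h(u) = ln f(x|\<theta> + u d)\<close>.
\<close>

lemma loglik_taylor_integral_remainder:
  assumes "open \<Theta>" "convex \<Theta>" "loglik_C2_on f x \<Theta>" "\<theta> \<in> \<Theta>" "\<theta> + d \<in> \<Theta>"
  shows "has_bochner_integral (restrict_space lborel {0..1})
      (\<lambda>u. (1 - u) * (d \<bullet> (hessian f x (\<theta> + u *\<^sub>R d) *v d)))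
      (ln (f x (\<theta> + d)) - ln (f x \<theta>) - score f x \<theta> \<bullet> d)"
proof -
  have seg: "\<theta> + u *\<^sub>R d \<in> \<Theta>" if "0 \<le> u" "u \<le> 1" for u
    using convexD_alt[OF assms(2,4,5) that] by (simp add: algebra_simps)
  let ?F = "\<lambda>u. ln (f x (\<theta> + u *\<^sub>R d)) + (1 - u) * (score f x (\<theta> + u *\<^sub>R d) \<bullet> d)"
  let ?q = "\<lambda>u. (1 - u) * (d \<bullet> (hessian f x (\<theta> + u *\<^sub>R d) *v d))"
  have "has_bochner_integral lborel (\<lambda>u. indicator {0..1} u *\<^sub>R ?q u) (?F 1 - ?F 0)"
  proof (rule has_bochner_integral_FTC_Icc)
    fix u :: real assume u: "0 \<le> u" "u \<le> 1"
    note D = loglik_C2_has_derivative[OF assms(1,3) seg[OF u]]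
    have line: "((\<lambda>u. \<theta> + u *\<^sub>R d) has_derivative (\<lambda>h. h *\<^sub>R d)) (at u within {0..1})"
      by (auto intro!: derivative_eq_intros)
    show "(?F has_vector_derivative ?q u) (at u within {0..1})"
      unfolding has_vector_derivative_def
      by (rule derivative_eq_intros has_derivative_compose[OF line D(1)]
          has_derivative_compose[OF line D(2)] refl | rule ext)+
        (simp add: matrix_vector_mult_scaleR inner_commute algebra_simps)
  next
    have "continuous_on \<Theta> (hessian f x)" using assms(3) by (simp add: loglik_C2_on_def)
    moreover have "continuous_on {0..1} (\<lambda>u. \<theta> + u *\<^sub>R d)" by (intro continuous_intros)
    moreover have "(\<lambda>u. \<theta> + u *\<^sub>R d) ` {0..1} \<subseteq> \<Theta>" using seg by auto
    ultimately have "continuous_on {0..1} (\<lambda>u. hessian f x (\<theta> + u *\<^sub>R d))"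
      by (rule continuous_on_compose2)
    then show "continuous_on {0..1} ?q"
      unfolding matrix_vector_mult_def by (intro continuous_intros)
  qed simp
  then show ?thesis by (simp add: has_bochner_integral_restrict_space diff_diff_eq)
qed

section \<open>Expectations under a density\<close>

lemma prob_space_law:
  assumes "Y \<in> sets borel" "is_density_on Y p"
  shows "prob_space (law Y p)"
proof
  have [measurable]: "p \<in> borel_measurable (restrict_space lborel Y)"
    using assms(2) by (simp add: is_density_on_def)
  have "emeasure (law Y p) (space (law Y p)) = (\<integral>\<^sup>+ x. ennreal (p x) \<partial>restrict_space lborel Y)"
    unfolding law_def by (subst emeasure_density) (auto intro!: nn_integral_cong)
  then show "emeasure (law Y p) (space (law Y p)) = 1"
    using assms(2) by (simp add: is_density_on_def)
qed

lemma space_law: "space (law Y p) = Y"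
  by (simp add: law_def space_restrict_space)

text \<open>
  Translates between expectations under \<open>law Y p\<close> and the density-weighted Lebesgue integrals in
  which the divergences are written.
\<close>

lemma integrable_law:
  fixes g :: "'a::euclidean_space \<Rightarrow> real"
  assumes Y: "Y \<in> sets borel" and p: "is_density_on Y p" and g: "integrable (law Y p) g"
  shows "set_integrable lborel Y (\<lambda>x. p x * g x)"
    and "(LINT x:Y|lborel. p x * g x) = (\<integral>x. g x \<partial>law Y p)"
proof -
  let ?R = "restrict_space lborel Y"
  have [measurable]: "p \<in> borel_measurable ?R" using p by (simp add: is_density_on_def)
  have nn: "AE x in ?R. 0 \<le> p x"
    using p by (intro AE_I2) (simp add: is_density_on_def space_restrict_space)
  have [measurable]: "g \<in> borel_measurable ?R"
    using borel_measurable_integrable[OF g] by (simp add: law_def)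
  have "integrable ?R (\<lambda>x. p x * g x)"
    using g nn by (simp add: law_def integrable_density)
  then show "set_integrable lborel Y (\<lambda>x. p x * g x)"
    using Y by (simp add: integrable_restrict_space set_integrable_def)
  have "(\<integral>x. g x \<partial>law Y p) = (\<integral>x. p x * g x \<partial>?R)"
    using nn by (simp add: law_def integral_density)
  then show "(LINT x:Y|lborel. p x * g x) = (\<integral>x. g x \<partial>law Y p)"
    using Y by (simp add: integral_restrict_space set_lebesgue_integral_def)
qed

section \<open>Expected log-likelihood gain\<close>

lemma quadratic_form_expectation:
  fixes M :: "'a \<Rightarrow> real^'k^'k"
  assumes "integrable P M"
  shows "(\<integral>x. d \<bullet> (M x *v d) \<partial>P) = d \<bullet> ((\<integral>x. M x \<partial>P) *v d)"
proof -
  have "linear (\<lambda>N::real^'k^'k. d \<bullet> (N *v d))"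
    by (rule linearI)
      (simp_all add: matrix_vector_mult_add_rdistrib inner_add_right
        flip: scaleR_matrix_vector_assoc)
  then have "bounded_linear (\<lambda>N::real^'k^'k. d \<bullet> (N *v d))"
    by (simp add: linear_conv_bounded_linear)
  then show ?thesis using assms by (rule integral_bounded_linear)
qed

lemma quadratic_form_ge_spectral_norm:
  "- (spectral_norm M * (norm d)\<^sup>2) \<le> d \<bullet> (M *v d)"
proof -
  have "\<bar>d \<bullet> (M *v d)\<bar> \<le> norm d * norm (M *v d)" by (rule Cauchy_Schwarz_ineq2)
  also have "\<dots> \<le> norm d * (spectral_norm M * norm d)"
    unfolding spectral_norm_def
    by (intro mult_left_mono onorm matrix_vector_mul_bounded_linear norm_ge_zero)
  finally show ?thesis by (simp add: power2_eq_square algebra_simps)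
qed

text \<open>
  Taking the expectation of the Taylor expansion and exchanging it with the remainder integral
  exposes the expected Hessian, whose quadratic form is at least \<open>- c |d|\<^sup>2\<close>; the weight \<open>1 - u\<close>
  integrates to \<open>1/2\<close>. Integrability of the gain is also obtained from this expansion.
\<close>

lemma expected_loglik_gain:
  assumes P: "prob_space P" and "open \<Theta>" "convex \<Theta>"
    and C2: "\<And>x. x \<in> space P \<Longrightarrow> loglik_C2_on f x \<Theta>"
    and \<theta>: "\<theta> \<in> \<Theta>" and \<eta>: "\<theta> + d \<in> \<Theta>"
    and score: "integrable P (\<lambda>x. score f x \<theta>)"
    and hess: "\<And>\<zeta>. \<zeta> \<in> \<Theta> \<Longrightarrow> integrable P (\<lambda>x. hessian f x \<zeta>)"
    and bound: "\<And>\<zeta>. \<zeta> \<in> \<Theta> \<Longrightarrow> spectral_norm (\<integral>x. hessian f x \<zeta> \<partial>P) \<le> c"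
    and fub: "integrable (P \<Otimes>\<^sub>M restrict_space lborel {0..1})
        (\<lambda>(x, u). d \<bullet> (hessian f x (\<theta> + u *\<^sub>R d) *v d))"
  shows "integrable P (\<lambda>x. ln (f x (\<theta> + d)) - ln (f x \<theta>))"
    and "(\<integral>x. score f x \<theta> \<partial>P) \<bullet> d - c / 2 * (norm d)\<^sup>2
          \<le> (\<integral>x. ln (f x (\<theta> + d)) - ln (f x \<theta>) \<partial>P)"
proof -
  let ?U = "restrict_space lborel {0..1::real}"
  let ?g = "\<lambda>x. ln (f x (\<theta> + d)) - ln (f x \<theta>)"
  let ?q = "\<lambda>x u. (1 - u) * (d \<bullet> (hessian f x (\<theta> + u *\<^sub>R d) *v d))"
  interpret P: prob_space P by (rule P)
  interpret U: sigma_finite_measure ?U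
    by (intro sigma_finite_measure_restrict_space lborel.sigma_finite_measure_axioms) simp
  interpret PU: pair_sigma_finite P ?U ..
  have seg: "\<theta> + u *\<^sub>R d \<in> \<Theta>" if "u \<in> {0..1}" for u
    using convexD_alt[OF \<open>convex \<Theta>\<close> \<theta> \<eta>, of u] that by (simp add: algebra_simps)
  \<comment> \<open>the weight \<open>1 - u\<close> is bounded by \<open>1\<close>, so it does not affect the Fubini condition\<close>
  have q: "integrable (P \<Otimes>\<^sub>M ?U) (\<lambda>(x, u). ?q x u)"
  proof (rule Bochner_Integration.integrable_bound[OF fub])
    have [measurable]: "(\<lambda>z. case z of (x, u) \<Rightarrow> d \<bullet> (hessian f x (\<theta> + u *\<^sub>R d) *v d))
        \<in> borel_measurable (P \<Otimes>\<^sub>M ?U)"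
      by (rule borel_measurable_integrable[OF fub])
    have "snd \<in> measurable (P \<Otimes>\<^sub>M ?U) ?U" by simp
    then have [measurable]: "(snd :: 'a \<times> real \<Rightarrow> real) \<in> borel_measurable (P \<Otimes>\<^sub>M ?U)"
      by (simp add: measurable_restrict_space2_iff)
    have "(\<lambda>z. (1 - snd z) * (case z of (x, u) \<Rightarrow> d \<bullet> (hessian f x (\<theta> + u *\<^sub>R d) *v d)))
        \<in> borel_measurable (P \<Otimes>\<^sub>M ?U)"
      by measurable
    then show "(\<lambda>(x, u). ?q x u) \<in> borel_measurable (P \<Otimes>\<^sub>M ?U)"
      by (simp add: case_prod_beta)
    show "AE z in P \<Otimes>\<^sub>M ?U. norm (case z of (x, u) \<Rightarrow> ?q x u)
        \<le> norm (case z of (x, u) \<Rightarrow> d \<bullet> (hessian f x (\<theta> + u *\<^sub>R d) *v d))"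
      by (intro AE_I2) (auto simp: space_pair_measure space_restrict_space abs_mult
          intro!: mult_left_le_one_le)
  qed
  have remainder: "(\<integral>u. ?q x u \<partial>?U) = ?g x - score f x \<theta> \<bullet> d" if "x \<in> space P" for x
    using loglik_taylor_integral_remainder[OF \<open>open \<Theta>\<close> \<open>convex \<Theta>\<close> C2[OF that] \<theta> \<eta>]
    by (simp add: has_bochner_integral_integral_eq)
  have "integrable P (\<lambda>x. \<integral>u. ?q x u \<partial>?U)" using PU.integrable_fst[OF q] .
  then have R: "integrable P (\<lambda>x. ?g x - score f x \<theta> \<bullet> d)"
    by (rule Bochner_Integration.integrable_cong[THEN iffD1, rotated 2]) (simp_all add: remainder)
  have S: "integrable P (\<lambda>x. score f x \<theta> \<bullet> d)" using score by simp
  show int: "integrable P ?g"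
    using Bochner_Integration.integrable_add[OF R S] by simp
  have "(\<integral>u. (1 - u) * (- (c * (norm d)\<^sup>2)) \<partial>?U)
      = - (c * (norm d)\<^sup>2) * (\<integral>u. (1 - u) * indicator {0..1} u \<partial>lborel)"
    by (simp add: integral_restrict_space mult_ac)
  also have "(\<integral>u. (1 - u) * indicator {0..1} u \<partial>lborel) = (1::real) / 2"
    by (subst integral_FTC_Icc_real[where F = "\<lambda>u. u - u\<^sup>2 / 2"])
      (auto intro!: derivative_eq_intros)
  finally have "- (c / 2 * (norm d)\<^sup>2) = (\<integral>u. (1 - u) * (- (c * (norm d)\<^sup>2)) \<partial>?U)"
    by simp
  also have "\<dots> \<le> (\<integral>u. (\<integral>x. ?q x u \<partial>P) \<partial>?U)"
  proof (rule integral_mono)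
    have "integrable lborel (\<lambda>u. (1 - u) * indicator {0..1::real} u)"
      by (rule borel_integrable_atLeastAtMost) (auto intro!: continuous_intros)
    then have "integrable ?U (\<lambda>u. 1 - u)"
      by (simp add: integrable_restrict_space mult_ac)
    then show "integrable ?U (\<lambda>u. (1 - u) * (- (c * (norm d)\<^sup>2)))"
      by (rule integrable_mult_left)
    show "integrable ?U (\<lambda>u. \<integral>x. ?q x u \<partial>P)" using PU.integrable_snd[OF q] .
    fix u assume "u \<in> space ?U"
    then have u: "u \<in> {0..1}" by (simp add: space_restrict_space)
    let ?H = "\<integral>x. hessian f x (\<theta> + u *\<^sub>R d) \<partial>P"
    have "(\<integral>x. ?q x u \<partial>P) = (1 - u) * (d \<bullet> (?H *v d))"
      by (simp add: quadratic_form_expectation[OF hess[OF seg[OF u]]])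
    moreover have "- (c * (norm d)\<^sup>2) \<le> d \<bullet> (?H *v d)"
      using quadratic_form_ge_spectral_norm[of ?H d]
        mult_right_mono[OF bound[OF seg[OF u]], of "(norm d)\<^sup>2"] by simp
    ultimately show "(1 - u) * (- (c * (norm d)\<^sup>2)) \<le> (\<integral>x. ?q x u \<partial>P)"
      using u by (simp only:) (intro mult_left_mono; simp)
  qed
  also have "\<dots> = (\<integral>x. (\<integral>u. ?q x u \<partial>?U) \<partial>P)" using PU.Fubini_integral[OF q] .
  also have "\<dots> = (\<integral>x. ?g x - score f x \<theta> \<bullet> d \<partial>P)"
    by (intro Bochner_Integration.integral_cong refl remainder)
  also have "\<dots> = (\<integral>x. ?g x \<partial>P) - (\<integral>x. score f x \<theta> \<partial>P) \<bullet> d"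
    using int score S by (simp add: Bochner_Integration.integral_diff integral_inner_left)
  finally show "(\<integral>x. score f x \<theta> \<partial>P) \<bullet> d - c / 2 * (norm d)\<^sup>2 \<le> (\<integral>x. ?g x \<partial>P)"
    by simp
qed

section \<open>Kullback-Leibler divergence after an update\<close>

text \<open>
  In the difference of two divergences the entropy of \<open>p\<close> cancels. Where \<open>p\<close> is positive so are both
  model densities, which justifies splitting the logarithms; elsewhere the integrands vanish.
\<close>

lemma EKL_predicted_diff:
  assumes Y: "Y \<in> sets borel" and p: "is_density_on Y p"
    and supp: "support_contained Y p f \<Theta>" and in_Theta: "\<theta> \<in> \<Theta>" "\<eta> \<in> \<Theta>"
    and fin: "set_integrable lborel Y (\<lambda>x. ln (p x / f x \<theta>) * p x)"
    and gain: "integrable (law Y p) (\<lambda>x. ln (f x \<eta>) - ln (f x \<theta>))"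
  shows "EKL_predicted Y p f \<eta> =
    EKL_predicted Y p f \<theta> - (\<integral>x. ln (f x \<eta>) - ln (f x \<theta>) \<partial>law Y p)"
proof -
  let ?g = "\<lambda>x. ln (f x \<eta>) - ln (f x \<theta>)"
  have pt: "ln (p x / f x \<eta>) * p x = ln (p x / f x \<theta>) * p x - p x * ?g x" if "x \<in> Y" for x
  proof (cases "p x = 0")
    case False
    then have "0 < p x" using p that by (auto simp: is_density_on_def less_le)
    moreover from this have "0 < f x \<theta>" "0 < f x \<eta>"
      using supp that in_Theta by (auto simp: support_contained_def)
    ultimately show ?thesis by (simp add: ln_div algebra_simps)
  qed simp
  have "EKL_predicted Y p f \<eta>
      = (LINT x:Y|lborel. ln (p x / f x \<theta>) * p x - p x * ?g x)"
    unfolding EKL_predicted_def using Y by (intro set_lebesgue_integral_cong) (auto simp: pt)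
  also have "\<dots> = EKL_predicted Y p f \<theta> - (LINT x:Y|lborel. p x * ?g x)"
    unfolding EKL_predicted_def
    by (rule set_integral_diff(2)[OF fin integrable_law(1)[OF Y p gain]])
  finally show ?thesis by (simp add: integrable_law(2)[OF Y p gain])
qed

text \<open>
  Conditionally on \<open>y\<close>, the inner integral is \<open>p y\<close> times the divergence at the fixed parameter
  \<open>\<phi> y \<theta>\<close>, so any pointwise bound on the divergence over \<open>\<Theta>\<close> can be averaged. Measurability of the
  inner integral in \<open>y\<close> comes with Fubini's theorem from the finiteness of the double integral.
\<close>

lemma EKL_updated_le:
  assumes Y: "Y \<in> sets borel" and p: "is_density_on Y p"
    and fin: "EKL_finite Y p f \<phi> \<theta>"
    and in_Theta: "AE y in law Y p. \<phi> y \<theta> \<in> \<Theta>"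
    and Q: "\<And>\<eta>. \<eta> \<in> \<Theta> \<Longrightarrow> EKL_predicted Y p f \<eta> \<le> Q \<eta>"
    and Q_int: "integrable (law Y p) (\<lambda>y. Q (\<phi> y \<theta>))"
  shows "EKL_updated Y p f \<phi> \<theta> \<le> (\<integral>y. Q (\<phi> y \<theta>) \<partial>law Y p)"
proof -
  let ?L = "\<lambda>y. LINT x:Y|lborel. ln (p x / f x (\<phi> y \<theta>)) * p x * p y"
  \<comment> \<open>also valid when the inner integrand is not integrable, since scaling by the constant
    \<open>p y\<close> commutes with the default value \<open>0\<close> of the integral\<close>
  have L: "?L y = p y * EKL_predicted Y p f (\<phi> y \<theta>)" for y
    unfolding EKL_predicted_def
    by (subst set_integral_mult_right[symmetric]) (simp add: mult_ac)
  have "integrable (lborel \<Otimes>\<^sub>M lborel) (\<lambda>(y, x). indicator (Y \<times> Y) (y, x) *\<^sub>R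
      (ln (p x / f x (\<phi> y \<theta>)) * p x * p y))"
    using fin by (simp add: EKL_finite_def set_integrable_def case_prod_beta')
  from lborel_pair.integrable_fst[OF this]
  have "set_integrable lborel Y ?L"
    unfolding set_integrable_def set_lebesgue_integral_def
    by (simp add: indicator_times mult.assoc)
  then have L_int: "set_integrable lborel Y (\<lambda>y. p y * EKL_predicted Y p f (\<phi> y \<theta>))"
    by (simp only: L)
  have "AE y in restrict_space lborel Y. 0 < ennreal (p y) \<longrightarrow> \<phi> y \<theta> \<in> \<Theta>"
    using in_Theta p unfolding law_def is_density_on_def by (subst (asm) AE_density) auto
  then have ae: "AE y in lborel. y \<in> Y \<longrightarrow> 0 < p y \<longrightarrow> \<phi> y \<theta> \<in> \<Theta>"
    using Y by (subst (asm) AE_restrict_space_iff) auto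
  have "EKL_updated Y p f \<phi> \<theta> = (LINT y:Y|lborel. p y * EKL_predicted Y p f (\<phi> y \<theta>))"
    by (simp only: EKL_updated_def L)
  also have "\<dots> \<le> (LINT y:Y|lborel. p y * Q (\<phi> y \<theta>))"
  proof (rule set_integral_mono_AE[OF L_int integrable_law(1)[OF Y p Q_int]])
    show "AE y\<in>Y in lborel. p y * EKL_predicted Y p f (\<phi> y \<theta>) \<le> p y * Q (\<phi> y \<theta>)"
      using ae
    proof eventually_elim
      case (elim y)
      show ?case
      proof
        assume "y \<in> Y"
        then have "0 \<le> p y" using p by (simp add: is_density_on_def)
        then show "p y * EKL_predicted Y p f (\<phi> y \<theta>) \<le> p y * Q (\<phi> y \<theta>)"
          using elim \<open>y \<in> Y\<close> Q by (cases "p y = 0") (auto intro!: mult_left_mono)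
      qed
    qed
  qed
  also have "\<dots> = (\<integral>y. Q (\<phi> y \<theta>) \<partial>law Y p)" by (rule integrable_law(2)[OF Y p Q_int])
  finally show ?thesis .
qed

section \<open>Second moments of the score\<close>

lemma integrable_score_products:
  assumes "integrable M (\<lambda>y. outer_prod (s y) (s y))"
  shows "integrable M (\<lambda>y. s y $ i * s y $ j)"
    and "(\<integral>y. outer_prod (s y) (s y) \<partial>M) $ i $ j = (\<integral>y. s y $ i * s y $ j \<partial>M)"
proof -
  have "bounded_linear (\<lambda>N::real^_^_. N $ i $ j)"
    using bounded_linear_compose[OF bounded_linear_vec_nth bounded_linear_vec_nth] .
  from integrable_bounded_linear[OF this assms] integral_bounded_linear[OF this assms]
  show "integrable M (\<lambda>y. s y $ i * s y $ j)"
    and "(\<integral>y. outer_prod (s y) (s y) \<partial>M) $ i $ j = (\<integral>y. s y $ i * s y $ j \<partial>M)"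
    by (simp_all add: outer_prod_def)
qed

text \<open>
  Mean and covariance enter the step-size conditions only through these sums, which are raw second
  moments.
\<close>

lemma score_second_moments:
  assumes "integrable (law Y p) (\<lambda>y. outer_prod (score f y \<theta>) (score f y \<theta>))"
  shows "integrable (law Y p) (\<lambda>y. (score f y \<theta> $ i)\<^sup>2)"
    and "(score_mean Y p f \<theta> $ i)\<^sup>2 + score_cov Y p f \<theta> $ i $ i
          = (\<integral>y. (score f y \<theta> $ i)\<^sup>2 \<partial>law Y p)"
    and "integrable (law Y p) (\<lambda>y. (norm (score f y \<theta>))\<^sup>2)"
    and "(norm (score_mean Y p f \<theta>))\<^sup>2 + trace (score_cov Y p f \<theta>)
          = (\<integral>y. (norm (score f y \<theta>))\<^sup>2 \<partial>law Y p)"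
proof -
  have norm: "(norm v)\<^sup>2 = (\<Sum>i\<in>UNIV. (v $ i)\<^sup>2)" for v :: "real^'k"
    unfolding power2_norm_eq_inner inner_vec_def by (simp add: power2_eq_square)
  show int: "integrable (law Y p) (\<lambda>y. (score f y \<theta> $ i)\<^sup>2)" for i
    using integrable_score_products(1)[OF assms, of i i] by (simp add: power2_eq_square)
  show eq: "(score_mean Y p f \<theta> $ i)\<^sup>2 + score_cov Y p f \<theta> $ i $ i
      = (\<integral>y. (score f y \<theta> $ i)\<^sup>2 \<partial>law Y p)" for i
    using integrable_score_products(2)[OF assms, of i i]
    by (simp add: score_cov_def outer_prod_def power2_eq_square)
  show "integrable (law Y p) (\<lambda>y. (norm (score f y \<theta>))\<^sup>2)"
    using int by (simp add: norm)
  have "(norm (score_mean Y p f \<theta>))\<^sup>2 + trace (score_cov Y p f \<theta>)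
      = (\<Sum>i\<in>UNIV. (score_mean Y p f \<theta> $ i)\<^sup>2 + score_cov Y p f \<theta> $ i $ i)"
    by (simp add: norm trace_def sum.distrib)
  also have "\<dots> = (\<integral>y. (norm (score f y \<theta>))\<^sup>2 \<partial>law Y p)"
    using int by (simp add: eq norm)
  finally show "(norm (score_mean Y p f \<theta>))\<^sup>2 + trace (score_cov Y p f \<theta>)
      = (\<integral>y. (norm (score f y \<theta>))\<^sup>2 \<partial>law Y p)" .
qed

section \<open>Score-driven updates\<close>

text \<open>
  The trade-off behind all step-size conditions: the first-order gain \<open>\<mu> \<bullet> A \<mu>\<close> against the
  curvature cost of the random step.
\<close>

lemma Delta_EKL_score_driven_le:
  assumes Y: "Y \<in> sets borel" and p: "is_density_on Y p"
    and Theta: "open \<Theta>" "convex \<Theta>" and \<theta>: "\<theta> \<in> \<Theta>"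
    and C2: "\<And>x. x \<in> Y \<Longrightarrow> loglik_C2_on f x \<Theta>"
    and score: "integrable (law Y p) (\<lambda>x. score f x \<theta>)"
    and step: "integrable (law Y p) (\<lambda>y. (norm (A *v score f y \<theta>))\<^sup>2)"
    and hess: "\<And>\<eta>. \<eta> \<in> \<Theta> \<Longrightarrow> integrable (law Y p) (\<lambda>x. hessian f x \<eta>)"
    and bound: "\<And>\<eta>. \<eta> \<in> \<Theta> \<Longrightarrow> spectral_norm (\<integral>x. hessian f x \<eta> \<partial>law Y p) \<le> c"
    and supp: "support_contained Y p f \<Theta>"
    and in_Theta: "AE y in law Y p. sd_update f A y \<theta> \<in> \<Theta>"
    and fin: "EKL_finite Y p f (sd_update f A) \<theta>"
    and fub: "taylor_interchange Y p f \<Theta> \<theta>"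
  shows "Delta_EKL Y f (sd_update f A) \<theta> p
    \<le> c / 2 * (\<integral>y. (norm (A *v score f y \<theta>))\<^sup>2 \<partial>law Y p)
      - score_mean Y p f \<theta> \<bullet> (A *v score_mean Y p f \<theta>)"
proof -
  interpret P: prob_space "law Y p" by (rule prob_space_law[OF Y p])
  define \<mu> where "\<mu> = score_mean Y p f \<theta>"
  define E0 where "E0 = EKL_predicted Y p f \<theta>"
  \<comment> \<open>the quadratic majorant of the divergence\<close>
  define Q where "Q \<eta> = E0 - (\<mu> \<bullet> (\<eta> - \<theta>) - c / 2 * (norm (\<eta> - \<theta>))\<^sup>2)" for \<eta>
  have descent: "EKL_predicted Y p f \<eta> \<le> Q \<eta>" if \<eta>: "\<eta> \<in> \<Theta>" for \<eta>
  proof -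
    have "\<theta> + (\<eta> - \<theta>) \<in> \<Theta>" using \<eta> by simp
    moreover have "loglik_C2_on f x \<Theta>" if "x \<in> space (law Y p)" for x
      using that by (simp add: space_law C2)
    moreover have "integrable (law Y p \<Otimes>\<^sub>M restrict_space lborel {0..1})
        (\<lambda>(x, u). (\<eta> - \<theta>) \<bullet> (hessian f x (\<theta> + u *\<^sub>R (\<eta> - \<theta>)) *v (\<eta> - \<theta>)))"
      using fub \<eta> by (simp add: taylor_interchange_def)
    ultimately have gain: "integrable (law Y p) (\<lambda>x. ln (f x \<eta>) - ln (f x \<theta>))"
      "\<mu> \<bullet> (\<eta> - \<theta>) - c / 2 * (norm (\<eta> - \<theta>))\<^sup>2
          \<le> (\<integral>x. ln (f x \<eta>) - ln (f x \<theta>) \<partial>law Y p)"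
      using expected_loglik_gain[where P = "law Y p" and d = "\<eta> - \<theta>" and f = f and c = c,
          OF P.prob_space_axioms Theta _ \<theta> _ score hess bound]
      by (simp_all add: \<mu>_def score_mean_def)
    have "set_integrable lborel Y (\<lambda>x. ln (p x / f x \<theta>) * p x)"
      using fin by (simp add: EKL_finite_def)
    from EKL_predicted_diff[OF Y p supp \<theta> \<eta> this gain(1)]
    show ?thesis using gain(2) by (simp add: Q_def E0_def)
  qed
  let ?Q = "\<lambda>y. E0 - (\<mu> \<bullet> (A *v score f y \<theta>) - c / 2 * (norm (A *v score f y \<theta>))\<^sup>2)"
  have Q: "Q (sd_update f A y \<theta>) = ?Q y" for y by (simp add: Q_def sd_update_def)
  note A = matrix_vector_mul_bounded_linear[of A]
  note As = integrable_bounded_linear[OF A score]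
  have mu_As: "integrable (law Y p) (\<lambda>y. \<mu> \<bullet> (A *v score f y \<theta>))"
    using As by (rule integrable_inner_right)
  have step': "integrable (law Y p) (\<lambda>y. c / 2 * (norm (A *v score f y \<theta>))\<^sup>2)"
    using step by (rule integrable_mult_right)
  have Q_int: "integrable (law Y p) (\<lambda>y. Q (sd_update f A y \<theta>))"
    unfolding Q by (intro Bochner_Integration.integrable_diff P.integrable_const mu_As step')
  have "EKL_updated Y p f (sd_update f A) \<theta> \<le> (\<integral>y. Q (sd_update f A y \<theta>) \<partial>law Y p)"
    by (rule EKL_updated_le[OF Y p fin in_Theta descent Q_int])
  also have "\<dots> = E0 - (\<mu> \<bullet> (\<integral>y. A *v score f y \<theta> \<partial>law Y p)
      - c / 2 * (\<integral>y. (norm (A *v score f y \<theta>))\<^sup>2 \<partial>law Y p))"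
    unfolding Q using mu_As step' As
    by (simp add: P.prob_space Bochner_Integration.integral_diff del: times_divide_eq_left)
  also have "(\<integral>y. A *v score f y \<theta> \<partial>law Y p) = A *v \<mu>"
    unfolding \<mu>_def score_mean_def by (rule integral_bounded_linear[OF A score])
  finally show ?thesis by (simp add: Delta_EKL_def E0_def \<mu>_def)
qed

lemma diag_mat_mult_vec: "(diag_mat a *v v) $ i = a $ i * v $ i"
  by (simp add: diag_mat_def matrix_vector_mult_def if_distrib[where f = "\<lambda>t. t * _"] cong: if_cong)

lemma pos_def_diag_mat:
  assumes "pos_def (diag_mat a)"
  shows "0 < a $ i"
proof -
  have "axis i (1::real) \<noteq> 0" by (simp add: axis_eq_0_iff)
  then have "0 < axis i 1 \<bullet> (diag_mat a *v axis i 1)"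
    using assms by (simp add: pos_def_def)
  then show ?thesis by (simp add: inner_axis' diag_mat_mult_vec)
qed

text \<open>
  Resolves a step-size condition, with \<open>b\<close> a squared mean and \<open>m\<close> a second moment. If \<open>m = 0\<close> the
  quotient is \<open>0\<close> by convention, and then \<open>0 < r\<close> contradicts the condition.
\<close>

lemma step_size_bound:
  fixes r c b m :: real
  assumes "0 < r" "0 < c" "0 \<le> m"
  shows "r < 2 / c * (b / m) \<Longrightarrow> c / 2 * (r * m) < b"
    and "r \<le> 2 / c * (b / m) \<Longrightarrow> c / 2 * (r * m) \<le> b"
  using assms by (cases "m = 0"; simp add: field_simps)+

theorem theorem3:
  fixes Y :: "(real^'l) set"
    and \<P> :: "(real^'l \<Rightarrow> real) set"
    and f :: "real^'l \<Rightarrow> real^'k \<Rightarrow> real"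
    and \<Theta> :: "(real^'k) set"
    and A :: "real^'k^'k"
    and c :: real
    and \<theta> :: "real^'k"
    and p :: "real^'l \<Rightarrow> real"
  assumes Y_borel: "Y \<in> sets borel"
    and class_densities: "\<And>q. q \<in> \<P> \<Longrightarrow> is_density_on Y q"
    and model_densities: "\<And>\<eta>. \<eta> \<in> \<Theta> \<Longrightarrow> is_density_on Y (\<lambda>x. f x \<eta>)"
    and A_pd: "pos_def A"
    and Theta_open: "open \<Theta>"
    and Theta_convex: "convex \<Theta>"
    and log_C2: "\<And>x. x \<in> Y \<Longrightarrow> loglik_C2_on f x \<Theta>"
    and score_integrable:
      "\<And>q \<eta>. q \<in> \<P> \<Longrightarrow> \<eta> \<in> \<Theta> \<Longrightarrow> integrable (law Y q) (\<lambda>x. score f x \<eta>)"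
    and step_square_integrable:
      "\<And>q \<eta>. q \<in> \<P> \<Longrightarrow> \<eta> \<in> \<Theta> \<Longrightarrow>
         integrable (law Y q) (\<lambda>y. (norm (update_step (sd_update f A) y \<eta>))\<^sup>2)"
    and c_pos: "0 < c"
    and hessian_integrable:
      "\<And>q \<eta>. q \<in> \<P> \<Longrightarrow> \<eta> \<in> \<Theta> \<Longrightarrow> integrable (law Y q) (\<lambda>x. hessian f x \<eta>)"
    and hessian_bound:
      "\<And>q \<eta>. q \<in> \<P> \<Longrightarrow> \<eta> \<in> \<Theta> \<Longrightarrow> spectral_norm (\<integral>x. hessian f x \<eta> \<partial>law Y q) \<le> c"
    and theta_in: "\<theta> \<in> \<Theta>"
    and p_in: "p \<in> \<P>"
    and p_support: "support_contained Y p f \<Theta>"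
    and update_in: "AE y in law Y p. sd_update f A y \<theta> \<in> \<Theta>"
    and finite_EKL: "EKL_finite Y p f (sd_update f A) \<theta>"
    and interchange: "taylor_interchange Y p f \<Theta> \<theta>"
    and mu_nonzero: "score_mean Y p f \<theta> \<noteq> 0"
    and second_moment_finite:
      "integrable (law Y p) (\<lambda>y. outer_prod (score f y \<theta>) (score f y \<theta>))"
  defines "\<mu> \<equiv> score_mean Y p f \<theta>"
    and "\<Sigma> \<equiv> score_cov Y p f \<theta>"
  shows
    "(\<forall>\<alpha>. A = \<alpha> *\<^sub>R mat 1 \<and>
          \<alpha> < 2 / c * ((norm \<mu>)\<^sup>2 / ((norm \<mu>)\<^sup>2 + trace \<Sigma>))
        \<longrightarrow> Delta_EKL Y f (sd_update f A) \<theta> p < 0) \<and>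
     (\<forall>\<alpha>. A = diag_mat \<alpha> \<and> (\<forall>i. \<mu> $ i \<noteq> 0) \<and>
          (\<forall>i. \<alpha> $ i \<le> 2 / c * ((\<mu> $ i)\<^sup>2 / ((\<mu> $ i)\<^sup>2 + \<Sigma> $ i $ i))) \<and>
          (\<exists>i. \<alpha> $ i < 2 / c * ((\<mu> $ i)\<^sup>2 / ((\<mu> $ i)\<^sup>2 + \<Sigma> $ i $ i)))
        \<longrightarrow> Delta_EKL Y f (sd_update f A) \<theta> p < 0) \<and>
     ((lambda_max A)\<^sup>2 / lambda_min A < 2 / c * ((norm \<mu>)\<^sup>2 / ((norm \<mu>)\<^sup>2 + trace \<Sigma>))
        \<longrightarrow> Delta_EKL Y f (sd_update f A) \<theta> p < 0)"
proof -
  let ?P = "law Y p" and ?s = "\<lambda>y. score f y \<theta>"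
  let ?D = "Delta_EKL Y f (sd_update f A) \<theta> p"
  have descent: "?D \<le> c / 2 * (\<integral>y. (norm (A *v ?s y))\<^sup>2 \<partial>?P) - \<mu> \<bullet> (A *v \<mu>)"
    unfolding \<mu>_def
    using step_square_integrable[OF p_in theta_in]
    by (intro Delta_EKL_score_driven_le[where \<Theta> = \<Theta>] Y_borel class_densities p_in Theta_open
        Theta_convex theta_in log_C2 score_integrable hessian_integrable hessian_bound p_support
        update_in finite_EKL interchange) (simp_all add: update_step_def sd_update_def)
  have As_int: "integrable ?P (\<lambda>y. (norm (A *v ?s y))\<^sup>2)"
    using step_square_integrable[OF p_in theta_in] by (simp add: update_step_def sd_update_def)
  note m2 = score_second_moments[OF second_moment_finite]
  define m where "m = (\<integral>y. (norm (?s y))\<^sup>2 \<partial>?P)"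
  have m: "(norm \<mu>)\<^sup>2 + trace \<Sigma> = m" unfolding \<mu>_def \<Sigma>_def m_def by (rule m2(4))
  have "0 \<le> m" unfolding m_def by (intro Bochner_Integration.integral_nonneg) simp
  have \<mu>: "0 < (norm \<mu>)\<^sup>2" using mu_nonzero by (simp add: \<mu>_def)
  have scalar: "?D < 0"
    if A: "A = \<alpha> *\<^sub>R mat 1" and \<alpha>: "\<alpha> < 2 / c * ((norm \<mu>)\<^sup>2 / ((norm \<mu>)\<^sup>2 + trace \<Sigma>))" for \<alpha>
  proof -
    have Av: "A *v v = \<alpha> *\<^sub>R v" for v by (simp add: A flip: scaleR_matrix_vector_assoc)
    have "0 < \<mu> \<bullet> (A *v \<mu>)" using A_pd mu_nonzero by (simp add: pos_def_def \<mu>_def)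
    then have "0 < \<alpha>" using \<mu> by (simp add: Av zero_less_mult_iff dot_square_norm)
    \<comment> \<open>one factor \<open>\<alpha>\<close> of the quadratic cost cancels against the linear gain\<close>
    have "c / 2 * (\<integral>y. (norm (A *v ?s y))\<^sup>2 \<partial>?P) = \<alpha> * (c / 2 * (\<alpha> * m))"
      by (simp add: Av power_mult_distrib m_def) (simp add: power2_eq_square)
    also have "\<dots> < \<alpha> * (norm \<mu>)\<^sup>2"
      using step_size_bound(1)[OF \<open>0 < \<alpha>\<close> c_pos \<open>0 \<le> m\<close>] \<alpha> \<open>0 < \<alpha>\<close>
      by (intro mult_strict_left_mono) (simp_all only: m)
    also have "\<dots> = \<mu> \<bullet> (A *v \<mu>)" by (simp add: Av dot_square_norm)
    finally show ?thesis using descent by simp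
  qed
  have diagonal: "?D < 0"
    if A: "A = diag_mat \<alpha>"
      and le: "\<forall>i. \<alpha> $ i \<le> 2 / c * ((\<mu> $ i)\<^sup>2 / ((\<mu> $ i)\<^sup>2 + \<Sigma> $ i $ i))"
      and lt: "\<exists>i. \<alpha> $ i < 2 / c * ((\<mu> $ i)\<^sup>2 / ((\<mu> $ i)\<^sup>2 + \<Sigma> $ i $ i))" for \<alpha>
  proof -
    define k where "k i = (\<integral>y. (?s y $ i)\<^sup>2 \<partial>?P)" for i
    have k: "(\<mu> $ i)\<^sup>2 + \<Sigma> $ i $ i = k i" for i
      unfolding \<mu>_def \<Sigma>_def k_def by (rule m2(2))
    have k0: "0 \<le> k i" for i unfolding k_def by (intro Bochner_Integration.integral_nonneg) simp
    have pos: "0 < \<alpha> $ i" for i using A_pd by (simp add: A pos_def_diag_mat)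
    have "(norm (A *v v))\<^sup>2 = (\<Sum>i\<in>UNIV. (\<alpha> $ i)\<^sup>2 * (v $ i)\<^sup>2)" for v
      unfolding power2_norm_eq_inner inner_vec_def A diag_mat_mult_vec
      by (simp add: power2_eq_square mult_ac)
    then have "c / 2 * (\<integral>y. (norm (A *v ?s y))\<^sup>2 \<partial>?P)
        = (\<Sum>i\<in>UNIV. \<alpha> $ i * (c / 2 * (\<alpha> $ i * k i)))"
      using m2(1) by (simp add: k_def power2_eq_square sum_distrib_left mult_ac)
    also have "\<dots> < (\<Sum>i\<in>UNIV. \<alpha> $ i * (\<mu> $ i)\<^sup>2)"
    proof (rule sum_strict_mono_ex1)
      show "\<forall>i\<in>UNIV. \<alpha> $ i * (c / 2 * (\<alpha> $ i * k i)) \<le> \<alpha> $ i * (\<mu> $ i)\<^sup>2"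
        using le pos step_size_bound(2)[OF pos c_pos k0]
        by (intro ballI mult_left_mono less_imp_le[OF pos]) (simp only: k)
      show "\<exists>i\<in>UNIV. \<alpha> $ i * (c / 2 * (\<alpha> $ i * k i)) < \<alpha> $ i * (\<mu> $ i)\<^sup>2"
      proof -
        obtain i where "\<alpha> $ i < 2 / c * ((\<mu> $ i)\<^sup>2 / k i)" using lt by (auto simp only: k)
        then have "c / 2 * (\<alpha> $ i * k i) < (\<mu> $ i)\<^sup>2"
          by (rule step_size_bound(1)[OF pos c_pos k0])
        then show ?thesis using pos by (intro bexI[of _ i] mult_strict_left_mono) simp_all
      qed
    qed simp
    also have "\<dots> = \<mu> \<bullet> (A *v \<mu>)"
      by (simp add: A inner_vec_def diag_mat_mult_vec power2_eq_square mult_ac)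
    finally show ?thesis using descent by simp
  qed
  have general: "?D < 0"
    if le: "(lambda_max A)\<^sup>2 / lambda_min A
      < 2 / c * ((norm \<mu>)\<^sup>2 / ((norm \<mu>)\<^sup>2 + trace \<Sigma>))"
  proof -
    define l L where "l = lambda_min A" and "L = lambda_max A"
    have l: "0 < l" unfolding l_def by (rule pos_def_lambda_min_pos[OF A_pd])
    have sym: "transpose A = A" using A_pd by (simp add: pos_def_def)
    have l_le: "l * (norm \<mu>)\<^sup>2 \<le> \<mu> \<bullet> (A *v \<mu>)"
      unfolding l_def by (rule lambda_min_quadratic_form_le[OF sym])
    have "l * (norm \<mu>)\<^sup>2 \<le> L * (norm \<mu>)\<^sup>2"
      using l_le quadratic_form_le_lambda_max[OF sym, of \<mu>] by (simp add: L_def)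
    \<comment> \<open>makes the ratio in the condition positive\<close>
    then have "0 < L" using l \<mu> by (simp add: mult_le_cancel_right)
    have "(\<integral>y. (norm (A *v ?s y))\<^sup>2 \<partial>?P) \<le> (\<integral>y. L\<^sup>2 * (norm (?s y))\<^sup>2 \<partial>?P)"
      unfolding L_def using m2(3)
      by (intro integral_mono As_int pos_def_norm_le_lambda_max[OF A_pd]) simp
    then have "c / 2 * (\<integral>y. (norm (A *v ?s y))\<^sup>2 \<partial>?P) \<le> c / 2 * (L\<^sup>2 * m)"
      using c_pos by (intro mult_left_mono) (simp_all add: m_def)
    also have "\<dots> = l * (c / 2 * (L\<^sup>2 / l * m))" using l by simp
    also have "\<dots> < l * (norm \<mu>)\<^sup>2"
      using step_size_bound(1)[OF _ c_pos \<open>0 \<le> m\<close>, of "L\<^sup>2 / l"] le l \<open>0 < L\<close>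
      by (intro mult_strict_left_mono) (simp_all only: m l_def L_def, simp)
    also note l_le
    finally show ?thesis using descent by simp
  qed
  show ?thesis using scalar diagonal general by blast
qed

end
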